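(* With the notation of the context, let $\mathcal{R}(\partial\omega^* )$ be the set of all random boundary displacements $g(x,\theta)$ on $\partial\omega^*$ with prescribed mean $\bar g(x)$ and prescribed covariance function $C(x_1,x_2)$. Let $\overline{P}$ be the associated expected proportion of energy contained in $\omega$, let $$P(\mathcal{R})=\sup\left\{P(g)\,:\, g=g(\cdot,\theta),\ g\in\mathcal{R}(\partial\omega^* )\right\}$$ be the maximum energy concentration over realizations of the random loads, and let $$V=\sup\left\{\frac{\|u\|^2_{\mathcal{E}(\omega)}}{\|u\|^2_{\mathcal{E}(\omega^* )}}\,:\ u\in H^1_{I0}(\omega^* ),\ \operatorname{div}\left(\mathbb{A}(x)e(u(x))\right)=0 \text{ in } \omega^*,\ \|u\|_{\mathcal{E}(\omega^* )}\neq0\right\}.$$ Then $$\overline{P}\le P(\mathcal{R})\le V.$$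
   Context: Setting. $\omega^*$ is a bounded domain (the structural domain) with sufficiently regular (e.g. Lipschitz) boundary. Its exterior boundary is denoted $\partial\omega^*$. The domain may contain holes away from the exterior boundary; the collection of the boundaries of these holes is denoted $\partial\omega_I^*$, and displacements are clamped (zero) there. The elasticity tensor $\mathbb{A}(x)=(\mathbb{A}_{ijkl}(x))$ is measurable, has the usual symmetries of an elasticity tensor (in particular $\mathbb{A}_{ijkl}=\mathbb{A}_{klij}$), and satisfies, for constants $0<\lambda_0<\Lambda$, $\lambda_0|\zeta|^2\le \mathbb{A}(x)\zeta:\zeta\le\Lambda|\zeta|^2$ for all constant strain tensors (symmetric matrices) $\zeta$, where $\mathbb{A}(x)\zeta:\zeta=\sum_{ijkl}\mathbb{A}_{ijkl}(x)\zeta_{kl}\zeta_{ij}$. The strain of a displacement $u$ is $e(u)=(\nabla u+\nabla u^T)/2$. The subdomain of interest $\omega\subset\omega^*$ is an open set whose boundary is at positive distance from $\partial\omega^*$. Spaces and energies. $H^1_{I0}(\omega^* )$ is the space of vector-valued displacements in $H^1(\omega^* )$ vanishing on $\partial\omega_I^*$. Each $g\in H^{1/2}(\partial\omega^* )$ is the trace on $\partial\omega^*$ of a unique weak solution $u\in H^1_{I0}(\omega^* )$ of $\operatorname{div}(\mathbb{A}(x)e(u(x)))=0$ in $\omega^*$. For $D=\omega$ or $D=\omega^*$, $(u,v)_{\mathcal{E}(D)}=\int_D\mathbb{A}(x)e(u):e(v)\,dx$ and $\|u\|^2_{\mathcal{E}(D)}=(u,u)_{\mathcal{E}(D)}$.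 For $g\in H^{1/2}(\partial\omega^* )$ with corresponding solution $u$ satisfying $\|u\|_{\mathcal{E}(\omega^* )}\ne0$, the energy concentration is $P(g)=\|u\|^2_{\mathcal{E}(\omega)}/\|u\|^2_{\mathcal{E}(\omega^* )}$. Random loads. A random boundary displacement is $g(x,\theta)=\bar g(x)+\alpha(x,\theta)$, where $\bar g$ is deterministic and $\alpha(x,\theta)$ is a zero-mean second order stochastic process with covariance function $C(x_1,x_2)$, $x_1,x_2\in\partial\omega^*$. Both $\bar g$ and the realizations $\alpha(\cdot,\theta)$ belong to $H^{1/2}(\partial\omega^* )$. Expectation is denoted $\langle\cdot\rangle$. Let $u(x,\theta)$ be the random solution in $H^1_{I0}(\omega^* )$ with $u(\cdot,\theta)=g(\cdot,\theta)$ on $\partial\omega^*$. The expected energies are $$\mathcal{E}(\omega)=\left\langle (u,u)_{\mathcal{E}(\omega)}\right\rangle,\qquad \mathcal{E}(\omega^* )=\left\langle (u,u)_{\mathcal{E}(\omega^* )}\right\rangle,$$ with $0<\mathcal{E}(\omega^* )<\infty$. They depend on the random load $g\in\mathcal{R}(\partial\omega^* )$ only through $\bar g$ and $C$. The expected proportion of energy contained in $\omega$ is $$\overline{P}=\frac{\mathcal{E}(\omega)}{\mathcal{E}(\omega^* )}.$$ *)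

theory Defs
  imports "HOL-Analysis.Analysis" "HOL-Probability.Probability"
begin

section \<open>Smooth functions and test functions\<close>

primrec C_k :: "nat \<Rightarrow> ('v::euclidean_space \<Rightarrow> 'b::real_normed_vector) \<Rightarrow> bool" where
  "C_k 0 f \<longleftrightarrow> continuous_on UNIV f"
| "C_k (Suc k) f \<longleftrightarrow> (\<forall>x. f differentiable (at x)) \<and>
     (\<forall>b\<in>Basis. C_k k (\<lambda>x. frechet_derivative f (at x) b))"

definition smooth :: "('v::euclidean_space \<Rightarrow> 'b::real_normed_vector) \<Rightarrow> bool" where
  "smooth f \<longleftrightarrow> (\<forall>k. C_k k f)"

definition test_functions ::
    "'v::euclidean_space set \<Rightarrow> ('v \<Rightarrow> 'b::real_normed_vector) set" where
  "test_functions \<Omega> =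
     {\<phi>. smooth \<phi> \<and> compact (closure {x. \<phi> x \<noteq> 0}) \<and> closure {x. \<phi> x \<noteq> 0} \<subseteq> \<Omega>}"

definition jacobian :: "(real^'n \<Rightarrow> real^'n) \<Rightarrow> real^'n \<Rightarrow> real^'n^'n" where
  "jacobian \<phi> x = matrix (frechet_derivative \<phi> (at x))"


section \<open>Surface measure\<close>

text \<open>
  The surface measure is the Hausdorff measure of dimension \<open>n - 1\<close> with the usual
  normalisation. Empty members of a cover count as zero even when \<open>n - 1 = 0\<close>.
\<close>

definition hausdorff_content :: "real \<Rightarrow> (real^'n) set \<Rightarrow> ennreal" where
  "hausdorff_content \<delta> S =
     (INF U \<in> {U :: nat \<Rightarrow> (real^'n) set.
                 S \<subseteq> (\<Union>k. U k) \<and> (\<forall>k. bounded (U k) \<and> diameter (U k) \<le> \<delta>)}.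
        \<Sum>k. if U k = {} then 0
             else ennreal (unit_ball_vol (real (CARD('n) - 1)) *
                           (diameter (U k) / 2) ^ (CARD('n) - 1)))"

definition surface_measure :: "(real^'n) measure" where
  "surface_measure =
     measure_of UNIV (sets borel) (\<lambda>S. SUP \<delta>\<in>{0<..}. hausdorff_content \<delta> S)"

definition boundary_measure :: "(real^'n) set \<Rightarrow> (real^'n) measure" where
  "boundary_measure \<Gamma> = completion (restrict_space surface_measure \<Gamma>)"


section \<open>The structural domain\<close>

text \<open>
  Near each boundary point the domain is, for a suitable unit vector \<open>\<nu>\<close>, the set of
  points lying strictly above the graph of a Lipschitz function \<open>\<gamma>\<close> of the component
  orthogonal to \<open>\<nu>\<close>.
\<close>

definition lipschitz_boundary :: "(real^'n) set \<Rightarrow> bool" where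
  "lipschitz_boundary \<Omega> \<longleftrightarrow>
     (\<forall>p\<in>frontier \<Omega>. \<exists>r>0. \<exists>\<nu> L \<gamma>. norm \<nu> = 1 \<and>
        L-lipschitz_on {y. y \<bullet> \<nu> = 0} \<gamma> \<and>
        (\<forall>x\<in>ball p r. x \<in> \<Omega> \<longleftrightarrow> (\<gamma> (x - (x \<bullet> \<nu>) *\<^sub>R \<nu>) :: real) < x \<bullet> \<nu>))"

definition structural_domain :: "(real^'n) set \<Rightarrow> bool" where
  "structural_domain \<Omega> \<longleftrightarrow>
     open \<Omega> \<and> connected \<Omega> \<and> \<Omega> \<noteq> {} \<and> bounded \<Omega> \<and> lipschitz_boundary \<Omega>"

definition exterior_boundary :: "(real^'n) set \<Rightarrow> (real^'n) set" where
  "exterior_boundary \<Omega> = frontier (outside (closure \<Omega>))"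

text \<open>The holes are the bounded components of the complement of the closed domain.\<close>

definition hole_boundary :: "(real^'n) set \<Rightarrow> (real^'n) set" where
  "hole_boundary \<Omega> = frontier (inside (closure \<Omega>))"


section \<open>Sobolev spaces and traces\<close>

definition square_integrable :: "'c measure \<Rightarrow> ('c \<Rightarrow> 'b::euclidean_space) \<Rightarrow> bool" where
  "square_integrable M f \<longleftrightarrow> f \<in> borel_measurable M \<and> integrable M (\<lambda>x. (norm (f x))\<^sup>2)"

text \<open>\<open>G x $ i $ j\<close> is the weak derivative of the \<open>i\<close>-th component in direction \<open>j\<close>.\<close>

definition is_weak_gradient ::
    "(real^'n) set \<Rightarrow> (real^'n \<Rightarrow> real^'n) \<Rightarrow> (real^'n \<Rightarrow> real^'n^'n) \<Rightarrow> bool" where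
  "is_weak_gradient \<Omega> u G \<longleftrightarrow>
     (\<forall>\<phi>\<in>test_functions \<Omega>. \<forall>i j.
        (LINT x|lebesgue_on \<Omega>. u x $ i * frechet_derivative \<phi> (at x) (axis j 1)) =
        - (LINT x|lebesgue_on \<Omega>. G x $ i $ j * (\<phi> x :: real)))"

text \<open>
  Elements of the Sobolev space are represented by functions; the weak gradient is
  unique up to null sets, so any choice of it gives the same integrals.
\<close>

definition H1 :: "(real^'n) set \<Rightarrow> (real^'n \<Rightarrow> real^'n) set" where
  "H1 \<Omega> = {u. square_integrable (lebesgue_on \<Omega>) u \<and>
     (\<exists>G. square_integrable (lebesgue_on \<Omega>) G \<and> is_weak_gradient \<Omega> u G)}"

definition weak_gradient ::
    "(real^'n) set \<Rightarrow> (real^'n \<Rightarrow> real^'n) \<Rightarrow> real^'n \<Rightarrow> real^'n^'n" where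
  "weak_gradient \<Omega> u =
     (SOME G. square_integrable (lebesgue_on \<Omega>) G \<and> is_weak_gradient \<Omega> u G)"

text \<open>
  The trace operator is the continuous extension, from the (dense) smooth fields to
  the Sobolev space, of restriction to the boundary part \<open>\<Gamma>\<close>. Below, \<open>g\<close> is the trace of \<open>u\<close>.
\<close>

definition has_trace ::
    "(real^'n) set \<Rightarrow> (real^'n) set \<Rightarrow> (real^'n \<Rightarrow> real^'n) \<Rightarrow> (real^'n \<Rightarrow> real^'n) \<Rightarrow> bool" where
  "has_trace \<Omega> \<Gamma> u g \<longleftrightarrow>
     square_integrable (boundary_measure \<Gamma>) g \<and>
     (\<exists>\<phi> :: nat \<Rightarrow> real^'n \<Rightarrow> real^'n. (\<forall>k. smooth (\<phi> k)) \<and>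
        (\<lambda>k. \<integral>\<^sup>+x. ennreal ((norm (\<phi> k x - u x))\<^sup>2 +
                          (norm (jacobian (\<phi> k) x - weak_gradient \<Omega> u x))\<^sup>2)
              \<partial>lebesgue_on \<Omega>) \<longlonglongrightarrow> 0 \<and>
        (\<lambda>k. \<integral>\<^sup>+x. ennreal ((norm (\<phi> k x - g x))\<^sup>2) \<partial>boundary_measure \<Gamma>) \<longlonglongrightarrow> 0)"

definition H_half :: "(real^'n) set \<Rightarrow> (real^'n) set \<Rightarrow> (real^'n \<Rightarrow> real^'n) set" where
  "H_half \<Omega> \<Gamma> = {g. \<exists>u\<in>H1 \<Omega>. has_trace \<Omega> \<Gamma> u g}"

definition H1_I0 :: "(real^'n) set \<Rightarrow> (real^'n \<Rightarrow> real^'n) set" where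
  "H1_I0 \<Omega> = {u \<in> H1 \<Omega>. has_trace \<Omega> (hole_boundary \<Omega>) u (\<lambda>x. 0)}"


section \<open>Elasticity\<close>

definition apply_tensor :: "real^'n^'n^'n^'n \<Rightarrow> real^'n^'n \<Rightarrow> real^'n^'n" where
  "apply_tensor T \<zeta> = (\<chi> i j. \<Sum>k\<in>UNIV. \<Sum>l\<in>UNIV. T $ i $ j $ k $ l * \<zeta> $ k $ l)"

text \<open>
  The inner product and norm of \<^typ>\<open>real^'n^'n\<close> are the Frobenius ones, i.e.
  \<open>\<sigma> \<bullet> \<zeta>\<close> is the contraction \<open>\<sigma> : \<zeta>\<close>.
\<close>

definition elasticity_tensor ::
    "(real^'n) set \<Rightarrow> real \<Rightarrow> real \<Rightarrow> (real^'n \<Rightarrow> real^'n^'n^'n^'n) \<Rightarrow> bool" where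
  "elasticity_tensor \<Omega> lam0 Lam A \<longleftrightarrow>
     A \<in> borel_measurable (lebesgue_on \<Omega>) \<and>
     (\<forall>x\<in>\<Omega>. \<forall>i j k l.
        A x $ i $ j $ k $ l = A x $ k $ l $ i $ j \<and>
        A x $ i $ j $ k $ l = A x $ j $ i $ k $ l \<and>
        A x $ i $ j $ k $ l = A x $ i $ j $ l $ k) \<and>
     0 < lam0 \<and> lam0 < Lam \<and>
     (\<forall>x\<in>\<Omega>. \<forall>\<zeta>. transpose \<zeta> = \<zeta> \<longrightarrow>
        lam0 * (norm \<zeta>)\<^sup>2 \<le> apply_tensor (A x) \<zeta> \<bullet> \<zeta> \<and>
        apply_tensor (A x) \<zeta> \<bullet> \<zeta> \<le> Lam * (norm \<zeta>)\<^sup>2)"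

definition strain :: "(real^'n) set \<Rightarrow> (real^'n \<Rightarrow> real^'n) \<Rightarrow> real^'n \<Rightarrow> real^'n^'n" where
  "strain \<Omega> u x = (1/2) *\<^sub>R (weak_gradient \<Omega> u x + transpose (weak_gradient \<Omega> u x))"

text \<open>Displacements live on \<open>\<Omega>\<close>; the energy is measured over a subset \<open>D\<close> of \<open>\<Omega>\<close>.\<close>

definition energy_inner ::
    "(real^'n \<Rightarrow> real^'n^'n^'n^'n) \<Rightarrow> (real^'n) set \<Rightarrow> (real^'n) set \<Rightarrow>
     (real^'n \<Rightarrow> real^'n) \<Rightarrow> (real^'n \<Rightarrow> real^'n) \<Rightarrow> real" where
  "energy_inner A \<Omega> D u v =
     (LINT x|lebesgue_on D. apply_tensor (A x) (strain \<Omega> u x) \<bullet> strain \<Omega> v x)"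

definition energy_norm ::
    "(real^'n \<Rightarrow> real^'n^'n^'n^'n) \<Rightarrow> (real^'n) set \<Rightarrow> (real^'n) set \<Rightarrow>
     (real^'n \<Rightarrow> real^'n) \<Rightarrow> real" where
  "energy_norm A \<Omega> D u = sqrt (energy_inner A \<Omega> D u u)"

text \<open>The equation \<open>div (A e(u)) = 0\<close> in \<open>\<Omega>\<close>, in the sense of distributions.\<close>

definition weak_equilibrium ::
    "(real^'n \<Rightarrow> real^'n^'n^'n^'n) \<Rightarrow> (real^'n) set \<Rightarrow> (real^'n \<Rightarrow> real^'n) \<Rightarrow> bool" where
  "weak_equilibrium A \<Omega> u \<longleftrightarrow>
     (\<forall>\<phi>\<in>test_functions \<Omega>.
        (LINT x|lebesgue_on \<Omega>. apply_tensor (A x) (strain \<Omega> u x) \<bullet> jacobian \<phi> x) = 0)"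

definition elastic_solutions ::
    "(real^'n \<Rightarrow> real^'n^'n^'n^'n) \<Rightarrow> (real^'n) set \<Rightarrow> (real^'n \<Rightarrow> real^'n) set" where
  "elastic_solutions A \<Omega> = {u \<in> H1_I0 \<Omega>. weak_equilibrium A \<Omega> u}"

definition solves_with_data ::
    "(real^'n \<Rightarrow> real^'n^'n^'n^'n) \<Rightarrow> (real^'n) set \<Rightarrow>
     (real^'n \<Rightarrow> real^'n) \<Rightarrow> (real^'n \<Rightarrow> real^'n) \<Rightarrow> bool" where
  "solves_with_data A \<Omega> g u \<longleftrightarrow>
     u \<in> elastic_solutions A \<Omega> \<and> has_trace \<Omega> (exterior_boundary \<Omega>) u g"

text \<open>
  \<open>has_energy_concentration A \<Omega> \<omega> g p\<close> means that \<open>P(g)\<close> is defined and equals \<open>p\<close>. It is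
  a relation, as the corresponding solution is determined only up to null sets.
\<close>

definition has_energy_concentration ::
    "(real^'n \<Rightarrow> real^'n^'n^'n^'n) \<Rightarrow> (real^'n) set \<Rightarrow> (real^'n) set \<Rightarrow>
     (real^'n \<Rightarrow> real^'n) \<Rightarrow> real \<Rightarrow> bool" where
  "has_energy_concentration A \<Omega> \<omega> g p \<longleftrightarrow>
     (\<exists>u. solves_with_data A \<Omega> g u \<and> energy_norm A \<Omega> \<Omega> u \<noteq> 0 \<and>
          p = (energy_norm A \<Omega> \<omega> u)\<^sup>2 / (energy_norm A \<Omega> \<Omega> u)\<^sup>2)"

definition worst_case_concentration ::
    "(real^'n \<Rightarrow> real^'n^'n^'n^'n) \<Rightarrow> (real^'n) set \<Rightarrow> (real^'n) set \<Rightarrow> real" where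
  "worst_case_concentration A \<Omega> \<omega> =
     Sup {(energy_norm A \<Omega> \<omega> u)\<^sup>2 / (energy_norm A \<Omega> \<Omega> u)\<^sup>2 | u.
            u \<in> elastic_solutions A \<Omega> \<and> energy_norm A \<Omega> \<Omega> u \<noteq> 0}"


section \<open>Random loads\<close>

text \<open>
  \<open>g x \<theta>\<close> is the load at the boundary point \<open>x\<close> for the outcome \<open>\<theta>\<close>; the covariance
  function is matrix valued because displacements are vectors.
\<close>

definition random_loads ::
    "'a measure \<Rightarrow> (real^'n) set \<Rightarrow> (real^'n \<Rightarrow> real^'n) \<Rightarrow>
     (real^'n \<Rightarrow> real^'n \<Rightarrow> real^'n^'n) \<Rightarrow> (real^'n \<Rightarrow> 'a \<Rightarrow> real^'n) set" where
  "random_loads M \<Omega> gbar C =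
     {g. \<exists>\<alpha> :: real^'n \<Rightarrow> 'a \<Rightarrow> real^'n.
        (\<forall>x\<in>exterior_boundary \<Omega>. \<forall>\<theta>\<in>space M. g x \<theta> = gbar x + \<alpha> x \<theta>) \<and>
        (\<forall>x\<in>exterior_boundary \<Omega>. square_integrable M (\<alpha> x)) \<and>
        (\<forall>x\<in>exterior_boundary \<Omega>. (LINT \<theta>|M. \<alpha> x \<theta>) = 0) \<and>
        (\<forall>x1\<in>exterior_boundary \<Omega>. \<forall>x2\<in>exterior_boundary \<Omega>. \<forall>i j.
           (LINT \<theta>|M. \<alpha> x1 \<theta> $ i * \<alpha> x2 \<theta> $ j) = C x1 x2 $ i $ j) \<and>
        (\<forall>\<theta>\<in>space M. (\<lambda>x. \<alpha> x \<theta>) \<in> H_half \<Omega> (exterior_boundary \<Omega>))}"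

definition max_realized_concentration ::
    "(real^'n \<Rightarrow> real^'n^'n^'n^'n) \<Rightarrow> (real^'n) set \<Rightarrow> (real^'n) set \<Rightarrow>
     'a measure \<Rightarrow> (real^'n \<Rightarrow> 'a \<Rightarrow> real^'n) set \<Rightarrow> real" where
  "max_realized_concentration A \<Omega> \<omega> M \<R> =
     Sup {p. \<exists>g\<in>\<R>. \<exists>\<theta>\<in>space M. has_energy_concentration A \<Omega> \<omega> (\<lambda>x. g x \<theta>) p}"

definition expected_energy ::
    "(real^'n \<Rightarrow> real^'n^'n^'n^'n) \<Rightarrow> (real^'n) set \<Rightarrow> (real^'n) set \<Rightarrow>
     'a measure \<Rightarrow> (real^'n \<Rightarrow> 'a \<Rightarrow> real^'n) \<Rightarrow> real" where
  "expected_energy A \<Omega> D M u = (LINT \<theta>|M. energy_inner A \<Omega> D (\<lambda>x. u x \<theta>) (\<lambda>x. u x \<theta>))"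

definition expected_proportion ::
    "(real^'n \<Rightarrow> real^'n^'n^'n^'n) \<Rightarrow> (real^'n) set \<Rightarrow> (real^'n) set \<Rightarrow>
     'a measure \<Rightarrow> (real^'n \<Rightarrow> 'a \<Rightarrow> real^'n) \<Rightarrow> real" where
  "expected_proportion A \<Omega> \<omega> M u = expected_energy A \<Omega> \<omega> M u / expected_energy A \<Omega> \<Omega> M u"

end

theory Submission
  imports Defs
begin

text \<open>
  For a single displacement the energy density \<open>A e(u) : e(u)\<close> is nonnegative, because the
  strain is a symmetric matrix and the tensor is coercive on those, and it is integrable over
  \<open>\<Omega>\<close>, because the tensor is bounded and the weak gradient is square integrable. Hence
  the energy over \<open>\<omega>\<close> is at most the energy over \<open>\<Omega>\<close> (\<open>energy_inner_mono\<close>), and every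
  energy concentration lies between 0 and 1. This boundedness is what makes the two suprema
  in the theorem meaningful as real numbers.

  Realised concentrations are concentrations of particular elastic solutions, so the second
  inequality is monotonicity of the supremum. For the first, let \<open>s\<close> be the supremum of the
  realised concentrations. For each realisation the energy over \<open>\<omega>\<close> is at most
  \<open>s\<close> times the energy over \<open>\<Omega>\<close>: by definition
  of \<open>s\<close> if the energy over \<open>\<Omega>\<close> is nonzero, and because both sides vanish otherwise.
  Taking expectations and dividing by the expected total energy gives the claim.
\<close>

section \<open>Strain and energy density\<close>

lemma norm_transpose_real: "norm (transpose B) = norm (B :: real^'n^'m)"
proof -
  have "transpose B \<bullet> transpose B = B \<bullet> B"
    unfolding inner_vec_def transpose_def by (simp, rule sum.swap)
  then show ?thesis by (simp add: norm_eq_sqrt_inner)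
qed

lemma square_integrable_weak_gradient:
  assumes "u \<in> H1 \<Omega>"
  shows "square_integrable (lebesgue_on \<Omega>) (weak_gradient \<Omega> u)"
proof -
  have "\<exists>G. square_integrable (lebesgue_on \<Omega>) G \<and> is_weak_gradient \<Omega> u G"
    using assms by (simp add: H1_def)
  from someI_ex[OF this] show ?thesis
    by (simp add: weak_gradient_def)
qed

lemma transpose_strain: "transpose (strain \<Omega> u x) = strain \<Omega> u x"
  by (simp add: strain_def transpose_def vec_eq_iff add.commute)

lemma norm_strain_le: "norm (strain \<Omega> u x) \<le> norm (weak_gradient \<Omega> u x)"
proof -
  have "norm (strain \<Omega> u x)
      \<le> (1/2) * (norm (weak_gradient \<Omega> u x) + norm (transpose (weak_gradient \<Omega> u x)))"
    unfolding strain_def norm_scaleR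
    using norm_triangle_ineq[of "weak_gradient \<Omega> u x" "transpose (weak_gradient \<Omega> u x)"]
    by simp
  then show ?thesis by (simp add: norm_transpose_real)
qed

lemma measurable_strain:
  assumes "u \<in> H1 \<Omega>"
  shows "strain \<Omega> u \<in> borel_measurable (lebesgue_on \<Omega>)"
proof -
  have "continuous_on UNIV (\<lambda>G::real^'n^'n. (1/2) *\<^sub>R (G + transpose G))"
    unfolding transpose_def
    by (intro continuous_intros continuous_on_vec_lambda)
  moreover have "weak_gradient \<Omega> u \<in> borel_measurable (lebesgue_on \<Omega>)"
    using square_integrable_weak_gradient[OF assms] by (simp add: square_integrable_def)
  ultimately show ?thesis
    unfolding strain_def by (rule borel_measurable_continuous_on)
qed

abbreviation energy_density ::
    "(real^'n \<Rightarrow> real^'n^'n^'n^'n) \<Rightarrow> (real^'n) set \<Rightarrow> (real^'n \<Rightarrow> real^'n) \<Rightarrow> real^'n \<Rightarrow> real" where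
  "energy_density A \<Omega> u x \<equiv> apply_tensor (A x) (strain \<Omega> u x) \<bullet> strain \<Omega> u x"

lemma measurable_energy_density:
  assumes "A \<in> borel_measurable (lebesgue_on \<Omega>)" and "u \<in> H1 \<Omega>"
  shows "energy_density A \<Omega> u \<in> borel_measurable (lebesgue_on \<Omega>)"
proof -
  have "continuous_on UNIV (\<lambda>p::(real^'n^'n^'n^'n) \<times> (real^'n^'n). apply_tensor (fst p) (snd p) \<bullet> snd p)"
    unfolding apply_tensor_def
    by (intro continuous_intros continuous_on_vec_lambda)
  moreover have "(\<lambda>x. (A x, strain \<Omega> u x)) \<in> borel_measurable (lebesgue_on \<Omega>)"
    using assms measurable_strain by (intro borel_measurable_Pair) auto
  ultimately have "(\<lambda>x. apply_tensor (fst (A x, strain \<Omega> u x)) (snd (A x, strain \<Omega> u x))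
      \<bullet> snd (A x, strain \<Omega> u x)) \<in> borel_measurable (lebesgue_on \<Omega>)"
    by (rule borel_measurable_continuous_on)
  then show ?thesis
    unfolding fst_conv snd_conv .
qed

lemma energy_density_nonneg:
  assumes "elasticity_tensor \<Omega> lam0 Lam A" and "x \<in> \<Omega>"
  shows "0 \<le> energy_density A \<Omega> u x"
proof -
  have "0 \<le> lam0 * (norm (strain \<Omega> u x))\<^sup>2"
    using assms by (simp add: elasticity_tensor_def)
  also have "\<dots> \<le> energy_density A \<Omega> u x"
    using assms transpose_strain unfolding elasticity_tensor_def by blast
  finally show ?thesis .
qed

text \<open>
  Integrability has to be established separately: the Bochner integral of a function that is
  not integrable is 0, so otherwise the energy over \<open>\<Omega>\<close> might not
  dominate that over \<open>\<omega>\<close>.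
\<close>

lemma integrable_energy_density:
  assumes "elasticity_tensor \<Omega> lam0 Lam A" and "u \<in> H1 \<Omega>" and "\<Omega> \<in> sets lebesgue"
  shows "integrable (lebesgue_on \<Omega>) (energy_density A \<Omega> u)"
proof (rule Bochner_Integration.integrable_bound)
  show "integrable (lebesgue_on \<Omega>) (\<lambda>x. Lam * (norm (weak_gradient \<Omega> u x))\<^sup>2)"
    using square_integrable_weak_gradient[OF assms(2)] by (simp add: square_integrable_def)
  show "energy_density A \<Omega> u \<in> borel_measurable (lebesgue_on \<Omega>)"
    using assms by (intro measurable_energy_density) (simp_all add: elasticity_tensor_def)
  have "norm (energy_density A \<Omega> u x) \<le> norm (Lam * (norm (weak_gradient \<Omega> u x))\<^sup>2)"
    if "x \<in> \<Omega>" for x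
  proof -
    have "0 < Lam"
      using assms(1) by (simp add: elasticity_tensor_def)
    have "energy_density A \<Omega> u x \<le> Lam * (norm (strain \<Omega> u x))\<^sup>2"
      using assms(1) that transpose_strain unfolding elasticity_tensor_def by blast
    also have "\<dots> \<le> Lam * (norm (weak_gradient \<Omega> u x))\<^sup>2"
      using \<open>0 < Lam\<close> norm_strain_le by (intro mult_left_mono power_mono) auto
    finally show ?thesis
      using energy_density_nonneg[OF assms(1) that] by auto
  qed
  then show "AE x in lebesgue_on \<Omega>. norm (energy_density A \<Omega> u x)
      \<le> norm (Lam * (norm (weak_gradient \<Omega> u x))\<^sup>2)"
    by (intro AE_I2) (simp add: assms(3))
qed


section \<open>Energies and their ratio\<close>

lemma energy_inner_nonneg:
  assumes "elasticity_tensor \<Omega> lam0 Lam A" and "D \<subseteq> \<Omega>"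
  shows "0 \<le> energy_inner A \<Omega> D u u"
  unfolding energy_inner_def
  using assms(2)
  by (intro integral_nonneg_AE AE_I2 energy_density_nonneg[OF assms(1)]) auto

lemma energy_inner_mono:
  assumes "elasticity_tensor \<Omega> lam0 Lam A" and "u \<in> H1 \<Omega>"
    and "\<Omega> \<in> sets lebesgue" and "D \<in> sets lebesgue" and "D \<subseteq> \<Omega>"
  shows "energy_inner A \<Omega> D u u \<le> energy_inner A \<Omega> \<Omega> u u"
  unfolding energy_inner_def
  using assms(3-5) integrable_energy_density[OF assms(1-3)]
  by (intro integral_mono_lebesgue_on_AE AE_I2 energy_density_nonneg[OF assms(1)]) auto

lemma energy_norm_squared:
  assumes "elasticity_tensor \<Omega> lam0 Lam A" and "D \<subseteq> \<Omega>"
  shows "(energy_norm A \<Omega> D u)\<^sup>2 = energy_inner A \<Omega> D u u"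
  using energy_inner_nonneg[OF assms] by (simp add: energy_norm_def)

lemma energy_ratio_le_1:
  assumes "elasticity_tensor \<Omega> lam0 Lam A" and "u \<in> H1 \<Omega>"
    and "\<Omega> \<in> sets lebesgue" and "D \<in> sets lebesgue" and "D \<subseteq> \<Omega>"
  shows "(energy_norm A \<Omega> D u)\<^sup>2 / (energy_norm A \<Omega> \<Omega> u)\<^sup>2 \<le> 1"
  using energy_inner_mono[OF assms] energy_inner_nonneg[OF assms(1), of \<Omega> u]
  by (auto simp: energy_norm_squared[OF assms(1)] assms(5) divide_le_eq_1)

lemma elastic_solutions_H1: "u \<in> elastic_solutions A \<Omega> \<Longrightarrow> u \<in> H1 \<Omega>"
  by (simp add: elastic_solutions_def H1_I0_def)


section \<open>Expected and extremal concentrations\<close>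

theorem mainTheorem3:
  fixes \<Omega> \<omega> :: "(real^'n) set"
    and A :: "real^'n \<Rightarrow> real^'n^'n^'n^'n"
    and lam0 Lam :: real
    and M :: "'a measure"
    and gbar :: "real^'n \<Rightarrow> real^'n"
    and C :: "real^'n \<Rightarrow> real^'n \<Rightarrow> real^'n^'n"
    and g u :: "real^'n \<Rightarrow> 'a \<Rightarrow> real^'n"
  assumes "structural_domain \<Omega>"
    and "elasticity_tensor \<Omega> lam0 Lam A"
    and "open \<omega>" and "\<omega> \<subseteq> \<Omega>"
    and "\<exists>d>0. \<forall>x\<in>frontier \<omega>. \<forall>y\<in>exterior_boundary \<Omega>. d \<le> dist x y"
    and "prob_space M"
    and "gbar \<in> H_half \<Omega> (exterior_boundary \<Omega>)"
    and "g \<in> random_loads M \<Omega> gbar C"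
    and "\<forall>\<theta>\<in>space M. solves_with_data A \<Omega> (\<lambda>x. g x \<theta>) (\<lambda>x. u x \<theta>)"
    and "integrable M (\<lambda>\<theta>. energy_inner A \<Omega> \<Omega> (\<lambda>x. u x \<theta>) (\<lambda>x. u x \<theta>))"
    and "0 < expected_energy A \<Omega> \<Omega> M u"
  shows "expected_proportion A \<Omega> \<omega> M u
           \<le> max_realized_concentration A \<Omega> \<omega> M (random_loads M \<Omega> gbar C)
       \<and> max_realized_concentration A \<Omega> \<omega> M (random_loads M \<Omega> gbar C)
           \<le> worst_case_concentration A \<Omega> \<omega>"
proof -
  define E where "E D \<theta> = energy_inner A \<Omega> D (\<lambda>x. u x \<theta>) (\<lambda>x. u x \<theta>)" for D \<theta>
  define R where "R = {p. \<exists>g\<in>random_loads M \<Omega> gbar C. \<exists>\<theta>\<in>space M.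
    has_energy_concentration A \<Omega> \<omega> (\<lambda>x. g x \<theta>) p}"
  define W where "W = {(energy_norm A \<Omega> \<omega> v)\<^sup>2 / (energy_norm A \<Omega> \<Omega> v)\<^sup>2 | v.
    v \<in> elastic_solutions A \<Omega> \<and> energy_norm A \<Omega> \<Omega> v \<noteq> 0}"
  note tensor = assms(2) and sub = assms(4)
  have meas: "\<Omega> \<in> sets lebesgue" "\<omega> \<in> sets lebesgue"
    using assms(1,3) by (auto simp: structural_domain_def intro: borel_open)
  have solution: "(\<lambda>x. u x \<theta>) \<in> elastic_solutions A \<Omega>" if "\<theta> \<in> space M" for \<theta>
    using assms(9) that by (simp add: solves_with_data_def)
  have E_nonneg: "0 \<le> E \<omega> \<theta>" "0 \<le> E \<Omega> \<theta>" for \<theta>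
    using energy_inner_nonneg[OF tensor] sub by (auto simp: E_def)
  have E_mono: "E \<omega> \<theta> \<le> E \<Omega> \<theta>" if "\<theta> \<in> space M" for \<theta>
    unfolding E_def
    using energy_inner_mono[OF tensor elastic_solutions_H1[OF solution[OF that]] meas sub] .

  have "R \<subseteq> W"
    by (auto simp: R_def W_def has_energy_concentration_def solves_with_data_def)
  have "bdd_above W"
    using energy_ratio_le_1[OF tensor elastic_solutions_H1 meas sub]
    by (auto simp: W_def intro!: bdd_aboveI[where M = 1])
  then have "bdd_above R"
    using \<open>R \<subseteq> W\<close> by (rule bdd_above_mono)
  have ratio_in_R: "E \<omega> \<theta> / E \<Omega> \<theta> \<in> R" if "\<theta> \<in> space M" "E \<Omega> \<theta> \<noteq> 0" for \<theta>
  proof -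
    have "energy_norm A \<Omega> \<Omega> (\<lambda>x. u x \<theta>) \<noteq> 0"
      using that(2) by (simp add: E_def energy_norm_def)
    then have "has_energy_concentration A \<Omega> \<omega> (\<lambda>x. g x \<theta>) (E \<omega> \<theta> / E \<Omega> \<theta>)"
      using assms(9) that(1) sub unfolding has_energy_concentration_def E_def
      by (intro exI[of _ "\<lambda>x. u x \<theta>"]) (simp add: energy_norm_squared[OF tensor])
    then show ?thesis
      using assms(8) that(1) unfolding R_def by blast
  qed

  have total_pos: "0 < (LINT \<theta>|M. E \<Omega> \<theta>)"
    using assms(11) by (simp add: expected_energy_def E_def)
  have "\<exists>\<theta>\<in>space M. E \<Omega> \<theta> \<noteq> 0"
  proof (rule ccontr)
    assume "\<not> ?thesis"
    then have "(LINT \<theta>|M. E \<Omega> \<theta>) = (LINT \<theta>|M. 0)"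
      by (intro Bochner_Integration.integral_cong) auto
    with total_pos show False by simp
  qed
  then obtain \<theta>0 where \<theta>0: "\<theta>0 \<in> space M" "E \<Omega> \<theta>0 \<noteq> 0" by blast
  then have "R \<noteq> {}"
    using ratio_in_R by blast
  have "0 \<le> E \<omega> \<theta>0 / E \<Omega> \<theta>0"
    using E_nonneg by simp
  also have "\<dots> \<le> Sup R"
    using ratio_in_R[OF \<theta>0] \<open>bdd_above R\<close> by (rule cSup_upper)
  finally have Sup_nonneg: "0 \<le> Sup R" .

  have pointwise: "E \<omega> \<theta> \<le> Sup R * E \<Omega> \<theta>" if "\<theta> \<in> space M" for \<theta>
  proof (cases "E \<Omega> \<theta> = 0")
    case True
    then show ?thesis
      using E_mono[OF that] by simp
  next
    case False
    then have "E \<omega> \<theta> / E \<Omega> \<theta> \<le> Sup R"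
      using ratio_in_R that \<open>bdd_above R\<close> by (intro cSup_upper)
    then show ?thesis
      using False E_nonneg(2)[of \<theta>] by (simp add: divide_le_eq)
  qed
  have "(LINT \<theta>|M. E \<omega> \<theta>) \<le> Sup R * (LINT \<theta>|M. E \<Omega> \<theta>)"
  proof -
    have int: "integrable M (\<lambda>\<theta>. Sup R * E \<Omega> \<theta>)"
      using assms(10) by (simp add: E_def)
    \<comment> \<open>This form of monotonicity needs integrability of the upper bound only. It covers a
      local energy that is not a measurable function of the outcome: its integral is then 0,
      and the right-hand side is nonnegative.\<close>
    have "(LINT \<theta>|M. E \<omega> \<theta>) \<le> (LINT \<theta>|M. Sup R * E \<Omega> \<theta>)"
      using int pointwise Sup_nonneg E_nonneg(2)
      by (intro integral_mono_AE') (auto intro!: AE_I2)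
    then show ?thesis by simp
  qed
  then have "expected_proportion A \<Omega> \<omega> M u \<le> Sup R"
    using total_pos
    by (simp add: expected_proportion_def expected_energy_def E_def divide_le_eq)
  moreover have "Sup R \<le> Sup W"
    using \<open>R \<noteq> {}\<close> \<open>bdd_above W\<close> \<open>R \<subseteq> W\<close> by (rule cSup_subset_mono)
  ultimately show ?thesis
    by (simp add: max_realized_concentration_def worst_case_concentration_def R_def W_def)
qed

end
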